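(* Let $(\boldsymbol V,\Phi)$ be an admissible primitive lattice substitution system. Then $(\boldsymbol V,\Phi)$ admits a modular coincidence (that is, for some integer $k\ge 0$ a modular coincidence relative to $Q^kL'$ occurs in $\Phi^k$) if and only if at least one vertex of the coincidence graph $G_{(\boldsymbol V,\Phi)}$ represents a singleton set. In that case, the length of a shortest directed path in $G_{(\boldsymbol V,\Phi)}$ from one of the base points $\Psi_0[a]$ ($a\in L$) to a vertex representing a singleton set is the minimal $k\ge 0$ such that a modular coincidence relative to $Q^kL'$ occurs in $\Phi^k$.
   Context: A matrix function system (MFS) is an $m\times m$ matrix $\Phi=(\Phi_{ij})$ whose entries are finite (possibly empty) sets of maps $x\mapsto Qx+a_{ijk}$ on $\mathbb R^d$, where $Q$ is one fixed expansive linear map (all eigenvalues of modulus $>1$) and $a_{ijk}\in\mathbb R^d$. It is primitive if its substitution matrix $S(\Phi)=(\#\Phi_{ij})_{i,j}$ is primitive, i.e. some power has only strictly positive entries. Powers are defined by composition: $(\Phi^{k+1})_{ij}=\bigcup_{\ell}\{g\circ f : g\in(\Phi^k)_{i\ell},\ f\in\Phi_{\ell j}\}$. For $\boldsymbol V=(V_1,\dots,V_m)^T$ with $V_i\subset\mathbb R^d$, $\Phi\boldsymbol V=(W_1,\dots,W_m)$ with $W_i=\bigcup_j\bigcup_{f\in\Phi_{ij}}f(V_j)$. A lattice substitution system (LSS) with $m$ components is a pair $(\boldsymbol V,\Phi)$ with $\Phi\boldsymbol V=\boldsymbol V$, the $V_i$ mutually disjoint, the unions $V_i=\bigcup_{j}\bigcup_{f\in\Phi_{ij}}f(V_j)$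 pairwise disjoint for every $i$, and $L:=\operatorname{supp}(\boldsymbol V)=\bigcup_iV_i$ a lattice in $\mathbb R^d$. It is primitive if $\Phi$ is. Standing assumption: for every $r>0$, every $r$-cluster $(V_1\cap(x+r\mathbb B^d),\dots,V_m\cap(x+r\mathbb B^d))$ of $\boldsymbol V$ ($\mathbb B^d$ the closed unit ball) is, up to translation, contained in $\Phi^k(\boldsymbol v)$ for some $k\in\mathbb N$ and some single point $\boldsymbol v$ of some type $i$ (a vector of sets whose $i$-th entry is a one-point set, all others being empty). A primitive LSS is admissible if the translational parts of all maps in $\Phi$ belong to one fixed system of representatives (containing $0$) in $L$ of $L/QL$. Put $L_i=\langle V_i-V_i\rangle_{\mathbb Z}$ and $L'=L_1+\dots+L_m$. For $k\ge0$ and $a\in L$ let $\Psi_k[a]=\{i : (a+Q^kL')\cap V_i\ne\varnothing\}\subset\{1,\dots,m\}$ (it depends only on $a$ modulo $Q^kL'$). A modular coincidence relative to $Q^kL'$ occurs in $\Phi^k$ if, for some $a\in L$, the set $\Phi^k[a]:=\bigcup_{i,j}\{\varphi\in(\Phi^k)_{ij} : \varphi(V_j)\subset a+Q^kL'\}$ is contained entirely in one row of $\Phi^k$, equivalently $a+Q^kL'\subset V_i$ for some $i$; for $k=0$ this means $a+L'\subset V_i$ for some $a\in L$ and some $i$. $\Psi_{k+1}[b]$ is a child of $\Psi_k[a]$ if there are $j\in\Psi_k[a]$, an index $i$, and $\varphi\in\Phi_{ij}$ with $\varphi(V_j)\subset b+QL'$ and $\varphi(a)\equiv b \bmod Q^{k+1}L'$.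 The coincidence graph $G_{(\boldsymbol V,\Phi)}$ is the directed (multi-)graph whose vertices represent the sets $\Psi_k[a]$ ($k\ge0$, $a\in L$), where $\Psi_k[a]$ and $\Psi_\ell[b]$ are represented by the same vertex whenever they are equal as subsets of $\{1,\dots,m\}$; there is an edge from $v_1$ to $v_2$ iff $v_2$ is a child of $v_1$ (i.e. $v_1=\Psi_k[a]$ and $v_2=\Psi_{k+1}[b]$ for some such parent-child pair). The vertices $\Psi_0[a]$, $a\in L$, are the base points. *)

theory Defs
  imports
    "HOL-Analysis.Analysis"
    "HOL-Computational_Algebra.Group_Closure"
    "HOL-Library.Set_Algebras"
    "Graph_Theory.Graph_Theory"
begin

text \<open>
  The component indices \<open>1, \<dots>, m\<close> are the elements of a finite type \<open>'m\<close>, and the ambient space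
  is \<open>real ^ 'd\<close>. A vector of sets is a function \<open>V :: 'm \<Rightarrow> (real ^ 'd) set\<close>.
\<close>

type_synonym ('d, 'm) mfs = "'m \<Rightarrow> 'm \<Rightarrow> (real ^ 'd \<Rightarrow> real ^ 'd) set"

text \<open>Eigenvalues are complex: those of the matrix of \<open>Q\<close> viewed over the complex numbers.\<close>

definition complex_eigenvalue :: "(real ^ 'd \<Rightarrow> real ^ 'd) \<Rightarrow> complex \<Rightarrow> bool" where
  "complex_eigenvalue Q z \<longleftrightarrow>
     (\<exists>v :: complex ^ 'd. v \<noteq> 0 \<and> map_matrix complex_of_real (matrix Q) *v v = z *s v)"

definition expansive :: "(real ^ 'd \<Rightarrow> real ^ 'd) \<Rightarrow> bool" where
  "expansive Q \<longleftrightarrow> linear Q \<and> (\<forall>z. complex_eigenvalue Q z \<longrightarrow> norm z > 1)"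

definition is_mfs :: "(real ^ 'd \<Rightarrow> real ^ 'd) \<Rightarrow> ('d, 'm) mfs \<Rightarrow> bool" where
  "is_mfs Q \<Phi> \<longleftrightarrow> expansive Q \<and>
     (\<forall>i j. finite (\<Phi> i j) \<and> (\<forall>f\<in>\<Phi> i j. \<exists>a. f = (\<lambda>x. Q x + a)))"

definition substitution_matrix :: "('d, 'm::finite) mfs \<Rightarrow> nat ^ 'm ^ 'm" where
  "substitution_matrix \<Phi> = (\<chi> i j. card (\<Phi> i j))"

definition primitive_matrix :: "nat ^ 'm::finite ^ 'm \<Rightarrow> bool" where
  "primitive_matrix S \<longleftrightarrow> (\<exists>n>0. \<forall>i j. (((**) S ^^ n) (mat 1)) $ i $ j > 0)"

definition primitive_mfs :: "('d, 'm::finite) mfs \<Rightarrow> bool" where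
  "primitive_mfs \<Phi> \<longleftrightarrow> primitive_matrix (substitution_matrix \<Phi>)"

fun mfs_power :: "('d, 'm) mfs \<Rightarrow> nat \<Rightarrow> ('d, 'm) mfs" where
  "mfs_power \<Phi> 0 i j = (if i = j then {id} else {})"
| "mfs_power \<Phi> (Suc k) i j = (\<Union>l. {g \<circ> f | g f. g \<in> mfs_power \<Phi> k i l \<and> f \<in> \<Phi> l j})"

definition mfs_apply :: "('d, 'm) mfs \<Rightarrow> ('m \<Rightarrow> (real ^ 'd) set) \<Rightarrow> 'm \<Rightarrow> (real ^ 'd) set" where
  "mfs_apply \<Phi> V i = (\<Union>j. \<Union>f\<in>\<Phi> i j. f ` V j)"

definition is_lattice :: "(real ^ 'd) set \<Rightarrow> bool" where
  "is_lattice L \<longleftrightarrow> (\<exists>B. independent B \<and> span B = UNIV \<and> L = group_closure B)"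

definition supp :: "('m \<Rightarrow> (real ^ 'd) set) \<Rightarrow> (real ^ 'd) set" where
  "supp V = (\<Union>i. V i)"

definition lattice_substitution_system ::
  "(real ^ 'd \<Rightarrow> real ^ 'd) \<Rightarrow> ('m \<Rightarrow> (real ^ 'd) set) \<Rightarrow> ('d, 'm) mfs \<Rightarrow> bool" where
  "lattice_substitution_system Q V \<Phi> \<longleftrightarrow>
     is_mfs Q \<Phi> \<and>
     mfs_apply \<Phi> V = V \<and>
     (\<forall>i j. i \<noteq> j \<longrightarrow> V i \<inter> V j = {}) \<and>
     (\<forall>i j j' f f'. f \<in> \<Phi> i j \<and> f' \<in> \<Phi> i j' \<and> (j, f) \<noteq> (j', f') \<longrightarrow> f ` V j \<inter> f' ` V j' = {}) \<and>
     is_lattice (supp V)"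

definition primitive_lss ::
  "(real ^ 'd \<Rightarrow> real ^ 'd) \<Rightarrow> ('m::finite \<Rightarrow> (real ^ 'd) set) \<Rightarrow> ('d, 'm) mfs \<Rightarrow> bool" where
  "primitive_lss Q V \<Phi> \<longleftrightarrow> lattice_substitution_system Q V \<Phi> \<and> primitive_mfs \<Phi>"

definition single_point :: "'m \<Rightarrow> real ^ 'd \<Rightarrow> 'm \<Rightarrow> (real ^ 'd) set" where
  "single_point i p j = (if j = i then {p} else {})"

definition clusters_generated :: "('m \<Rightarrow> (real ^ 'd) set) \<Rightarrow> ('d, 'm) mfs \<Rightarrow> bool" where
  "clusters_generated V \<Phi> \<longleftrightarrow>
     (\<forall>r>0. \<forall>x. \<exists>t k i p. \<forall>l.
        (+) t ` (V l \<inter> cball x r) \<subseteq> mfs_apply (mfs_power \<Phi> k) (single_point i p) l)"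

definition representatives ::
  "(real ^ 'd \<Rightarrow> real ^ 'd) \<Rightarrow> (real ^ 'd) set \<Rightarrow> (real ^ 'd) set \<Rightarrow> bool" where
  "representatives Q L D \<longleftrightarrow> D \<subseteq> L \<and> (\<forall>x\<in>L. \<exists>!d. d \<in> D \<and> x - d \<in> Q ` L)"

definition admissible ::
  "(real ^ 'd \<Rightarrow> real ^ 'd) \<Rightarrow> ('m \<Rightarrow> (real ^ 'd) set) \<Rightarrow> ('d, 'm) mfs \<Rightarrow> bool" where
  "admissible Q V \<Phi> \<longleftrightarrow>
     (\<exists>D. representatives Q (supp V) D \<and> 0 \<in> D \<and>
          (\<forall>i j. \<forall>f\<in>\<Phi> i j. \<exists>a\<in>D. f = (\<lambda>x. Q x + a)))"

definition component_lattice :: "('m \<Rightarrow> (real ^ 'd) set) \<Rightarrow> 'm \<Rightarrow> (real ^ 'd) set" where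
  "component_lattice V i = group_closure {x - y | x y. x \<in> V i \<and> y \<in> V i}"

text \<open>\<open>L' = L\<^sub>1 + \<dots> + L\<^sub>m\<close>; the sum is the elementwise sum of sets.\<close>

definition sum_lattice :: "('m::finite \<Rightarrow> (real ^ 'd) set) \<Rightarrow> (real ^ 'd) set" where
  "sum_lattice V = (\<Sum>i\<in>UNIV. component_lattice V i)"

definition coset ::
  "(real ^ 'd \<Rightarrow> real ^ 'd) \<Rightarrow> ('m::finite \<Rightarrow> (real ^ 'd) set) \<Rightarrow> nat \<Rightarrow> real ^ 'd \<Rightarrow> (real ^ 'd) set" where
  "coset Q V k a = (+) a ` (Q ^^ k) ` sum_lattice V"

definition Psi ::
  "(real ^ 'd \<Rightarrow> real ^ 'd) \<Rightarrow> ('m::finite \<Rightarrow> (real ^ 'd) set) \<Rightarrow> nat \<Rightarrow> real ^ 'd \<Rightarrow> 'm set" where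
  "Psi Q V k a = {i. coset Q V k a \<inter> V i \<noteq> {}}"

text \<open>
  \<open>\<Phi>\<^sup>k[a]\<close> as a set of matrix entries: each map carries its position \<open>(i, j)\<close>, so that the same
  map occurring in two different rows counts as two entries.
\<close>

definition mfs_entries ::
  "(real ^ 'd \<Rightarrow> real ^ 'd) \<Rightarrow> ('m::finite \<Rightarrow> (real ^ 'd) set) \<Rightarrow> ('d, 'm) mfs \<Rightarrow> nat \<Rightarrow> real ^ 'd
     \<Rightarrow> ('m \<times> 'm \<times> (real ^ 'd \<Rightarrow> real ^ 'd)) set" where
  "mfs_entries Q V \<Phi> k a =
     {(i, j, f). f \<in> mfs_power \<Phi> k i j \<and> f ` V j \<subseteq> coset Q V k a}"

fun modular_coincidence ::
  "(real ^ 'd \<Rightarrow> real ^ 'd) \<Rightarrow> ('m::finite \<Rightarrow> (real ^ 'd) set) \<Rightarrow> ('d, 'm) mfs \<Rightarrow> nat \<Rightarrow> bool" where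
  "modular_coincidence Q V \<Phi> 0 \<longleftrightarrow> (\<exists>a\<in>supp V. \<exists>i. coset Q V 0 a \<subseteq> V i)"
| "modular_coincidence Q V \<Phi> (Suc k) \<longleftrightarrow>
     (\<exists>a\<in>supp V. \<exists>i. \<forall>(i', j, f)\<in>mfs_entries Q V \<Phi> (Suc k) a. i' = i)"

text \<open>\<open>is_child Q V \<Phi> k a b\<close>: \<open>\<Psi>\<^bsub>k+1\<^esub>[b]\<close> is a child of \<open>\<Psi>\<^sub>k[a]\<close>.\<close>

definition is_child ::
  "(real ^ 'd \<Rightarrow> real ^ 'd) \<Rightarrow> ('m::finite \<Rightarrow> (real ^ 'd) set) \<Rightarrow> ('d, 'm) mfs
     \<Rightarrow> nat \<Rightarrow> real ^ 'd \<Rightarrow> real ^ 'd \<Rightarrow> bool" where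
  "is_child Q V \<Phi> k a b \<longleftrightarrow>
     (\<exists>j\<in>Psi Q V k a. \<exists>i. \<exists>f\<in>\<Phi> i j.
        f ` V j \<subseteq> coset Q V 1 b \<and> f a - b \<in> (Q ^^ Suc k) ` sum_lattice V)"

text \<open>
  Vertices are the sets \<open>\<Psi>\<^sub>k[a]\<close> themselves, so that equal sets are identified. Parallel
  edges are not recorded; they do not affect the existence or the length of paths.
\<close>

definition coincidence_graph ::
  "(real ^ 'd \<Rightarrow> real ^ 'd) \<Rightarrow> ('m::finite \<Rightarrow> (real ^ 'd) set) \<Rightarrow> ('d, 'm) mfs
     \<Rightarrow> ('m set, 'm set \<times> 'm set) pre_digraph" where
  "coincidence_graph Q V \<Phi> =
     \<lparr>verts = {Psi Q V k a | k a. a \<in> supp V},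
      arcs = {(Psi Q V k a, Psi Q V (Suc k) b) | k a b.
                a \<in> supp V \<and> b \<in> supp V \<and> is_child Q V \<Phi> k a b},
      tail = fst, head = snd\<rparr>"

definition base_points ::
  "(real ^ 'd \<Rightarrow> real ^ 'd) \<Rightarrow> ('m::finite \<Rightarrow> (real ^ 'd) set) \<Rightarrow> 'm set set" where
  "base_points Q V = {Psi Q V 0 a | a. a \<in> supp V}"

definition singleton_path_length ::
  "(real ^ 'd \<Rightarrow> real ^ 'd) \<Rightarrow> ('m::finite \<Rightarrow> (real ^ 'd) set) \<Rightarrow> ('d, 'm) mfs \<Rightarrow> nat \<Rightarrow> bool" where
  "singleton_path_length Q V \<Phi> n \<longleftrightarrow>
     (\<exists>u\<in>base_points Q V. \<exists>v\<in>verts (coincidence_graph Q V \<Phi>). \<exists>p.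
        is_singleton v \<and> pre_digraph.apath (coincidence_graph Q V \<Phi>) u p v \<and> length p = n)"

end

theory Submission
  imports Defs
begin

text \<open>
  Since \<open>\<Phi>\<^sup>k V = V\<close>, a component \<open>V\<^sub>i\<close> is the union of the pieces \<open>\<phi>(V\<^sub>j)\<close> with \<open>\<phi>\<close> in row \<open>i\<close> of
  \<open>\<Phi>\<^sup>k\<close>. The differences of points of \<open>V\<^sub>j\<close> lie in \<open>L'\<close>, so each piece lies inside a single coset of
  \<open>Q\<^sup>k L'\<close>. Hence \<open>i\<close> belongs to \<open>\<Psi>\<^sub>k[a]\<close> exactly when \<open>\<Phi>\<^sup>k[a]\<close> has an entry in row \<open>i\<close>, and a modular
  coincidence relative to \<open>Q\<^sup>k L'\<close> is the same thing as a singleton among the sets \<open>\<Psi>\<^sub>k[a]\<close>, \<open>a \<in> L\<close>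
  (\<open>modular_coincidence_iff\<close>). This already gives the equivalence with the existence of a singleton
  vertex.

  The statement about path lengths is not immediate, because a vertex forgets the level \<open>k\<close> at which
  its set occurs: consecutive edges of a path might come from unrelated levels. Admissibility rules
  this out. If \<open>x \<mapsto> Q x + d\<close> is a map in a column \<open>j \<in> \<Psi>\<^sub>k[a]\<close> and \<open>b = Q a + d\<close>, then a point
  \<open>Q y + d'\<close> of a piece can lie in \<open>b + Q\<^sup>k\<^sup>+\<^sup>1 L'\<close> only if \<open>d' - d \<in> Q L\<close>, that is \<open>d' = d\<close>, and
  then only if \<open>y \<in> a + Q\<^sup>k L'\<close>, since \<open>Q\<close> is injective. So \<open>\<Psi>\<^sub>k\<^sub>+\<^sub>1[b]\<close> consists of the rows \<open>i\<close> for
  which some column in \<open>\<Psi>\<^sub>k[a]\<close> has the map \<open>x \<mapsto> Q x + d\<close> in row \<open>i\<close>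
  (\<open>Psi_Suc_eq_successor\<close>). The children of \<open>\<Psi>\<^sub>k[a]\<close> therefore depend on the set \<open>\<Psi>\<^sub>k[a]\<close> alone, and
  every walk of length \<open>n\<close> from a base point ends in some \<open>\<Psi>\<^sub>n[b]\<close> (\<open>walk_lift\<close>).

  Conversely, every \<open>\<Psi>\<^sub>k[b]\<close> is reached from a base point by a walk of length \<open>k\<close>, because every set at
  level \<open>k + 1\<close> has a parent at level \<open>k\<close> (\<open>walk_from_base_point\<close>). When \<open>k\<close> is the least level with a
  modular coincidence, such a walk to a singleton repeats no vertex: cutting out a cycle would leave
  a shorter walk and thus a coincidence at a lower level.
\<close>

section \<open>Subgroups and the lattice \<open>L'\<close>\<close>

lemma group_closure_least:
  fixes H :: "'a::ab_group_add set"
  assumes "S \<subseteq> H" "0 \<in> H" "\<And>x y. x \<in> H \<Longrightarrow> y \<in> H \<Longrightarrow> x - y \<in> H"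
  shows "group_closure S \<subseteq> H"
proof
  fix x assume "x \<in> group_closure S"
  then show "x \<in> H" by induction (use assms in auto)
qed

text \<open>
  As a closure, \<open>L'\<close> comes with an induction principle: a property of subgroups passes to \<open>L'\<close> once it
  holds for the differences inside the components.
\<close>

lemma sum_lattice_eq_group_closure:
  "sum_lattice V = group_closure (\<Union>i. {x - y | x y. x \<in> V i \<and> y \<in> V i})"
    (is "_ = group_closure ?S")
proof
  have comp: "component_lattice V i \<subseteq> group_closure ?S" for i
    unfolding component_lattice_def
    by (rule group_closure_least) (auto intro: group_closure.intros)
  show "sum_lattice V \<subseteq> group_closure ?S"
  proof
    fix x assume "x \<in> sum_lattice V"
    then obtain s where s: "\<And>i. s i \<in> component_lattice V i" "x = sum s UNIV"
      by (auto simp: sum_lattice_def set_sum_alt)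
    have "sum s A \<in> group_closure ?S" for A :: "'b set"
      by (induction A rule: infinite_finite_induct)
        (use s comp in \<open>auto intro!: group_closure_add\<close>)
    then show "x \<in> group_closure ?S" using s by simp
  qed
  show "group_closure ?S \<subseteq> sum_lattice V"
  proof (rule group_closure_least)
    show "?S \<subseteq> sum_lattice V"
    proof
      fix z assume "z \<in> ?S"
      then obtain i where i: "z \<in> component_lattice V i"
        by (auto simp: component_lattice_def intro: group_closure.base)
      define s where "s = (\<lambda>j. if j = i then z else 0)"
      have "\<forall>j. s j \<in> component_lattice V j"
        using i by (simp add: s_def component_lattice_def)
      moreover have "z = sum s UNIV" by (simp add: s_def)
      ultimately show "z \<in> sum_lattice V"
        by (auto simp: sum_lattice_def set_sum_alt)
    qed
    have "\<forall>i. (\<lambda>_. 0) i \<in> component_lattice V i"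
      by (simp add: component_lattice_def)
    then show "0 \<in> sum_lattice V"
      unfolding sum_lattice_def set_sum_alt[OF finite]
      by (intro CollectI exI[of _ "\<lambda>_. 0"]) simp
    fix x y assume "x \<in> sum_lattice V" "y \<in> sum_lattice V"
    then obtain s t where "\<And>i. s i \<in> component_lattice V i" "x = sum s UNIV"
      "\<And>i. t i \<in> component_lattice V i" "y = sum t UNIV"
      by (auto simp: sum_lattice_def set_sum_alt)
    then have "x - y = (\<Sum>i\<in>UNIV. s i - t i)" "\<forall>i. s i - t i \<in> component_lattice V i"
      by (auto simp: sum_subtractf component_lattice_def intro: group_closure.diff)
    then show "x - y \<in> sum_lattice V"
      by (auto simp: sum_lattice_def set_sum_alt)
  qed
qed

section \<open>Expansive maps, powers and primitivity\<close>

text \<open>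
  A nonzero real vector in the kernel of \<open>Q\<close> would be a complex eigenvector for the eigenvalue \<open>0\<close>,
  whose modulus is not greater than \<open>1\<close>.
\<close>

lemma expansive_inj:
  assumes "expansive Q"
  shows "inj Q"
proof -
  have Q_linear: "linear Q" using assms by (simp add: expansive_def)
  have "x = 0" if "Q x = 0" for x
  proof (rule ccontr)
    assume "x \<noteq> 0"
    define v :: "complex ^ 'a" where "v = (\<chi> i. complex_of_real (x $ i))"
    have "v \<noteq> 0" using \<open>x \<noteq> 0\<close> by (auto simp: v_def vec_eq_iff)
    have "(map_matrix complex_of_real (matrix Q) *v v) $ i = complex_of_real ((matrix Q *v x) $ i)" for i
      by (simp add: matrix_vector_mult_def map_matrix_def v_def)
    then have "map_matrix complex_of_real (matrix Q) *v v = 0 *s v"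
      using that Q_linear by (simp add: vec_eq_iff matrix_works)
    with \<open>v \<noteq> 0\<close> have "complex_eigenvalue Q 0"
      unfolding complex_eigenvalue_def by blast
    with assms show False by (auto simp: expansive_def)
  qed
  then show ?thesis using Q_linear by (simp add: linear_injective_0)
qed

lemma fixed_point_component_iff:
  assumes "mfs_apply \<Phi> V = V"
  shows "x \<in> V i \<longleftrightarrow> (\<exists>j f y. f \<in> \<Phi> i j \<and> y \<in> V j \<and> x = f y)"
proof -
  have "x \<in> V i \<longleftrightarrow> x \<in> mfs_apply \<Phi> V i" using assms by simp
  then show ?thesis by (auto simp: mfs_apply_def)
qed

lemma mfs_power_fixed_point:
  assumes "mfs_apply \<Phi> V = V"
  shows "mfs_apply (mfs_power \<Phi> k) V = V"
proof (induction k)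
  case 0
  show ?case by (auto simp: mfs_apply_def fun_eq_iff split: if_splits)
next
  case (Suc k)
  have "mfs_apply (mfs_power \<Phi> (Suc k)) V i = mfs_apply (mfs_power \<Phi> k) (mfs_apply \<Phi> V) i" for i
    unfolding mfs_apply_def by (force simp: image_iff)
  then show ?case unfolding assms Suc by (intro ext)
qed

lemma linear_funpow:
  fixes Q :: "'a::real_vector \<Rightarrow> 'a"
  shows "linear Q \<Longrightarrow> linear (Q ^^ k)"
  by (induction k) (auto intro: linear_compose simp: linear_id)

lemma mfs_power_affine:
  assumes "linear Q" "\<And>i j f. f \<in> \<Phi> i j \<Longrightarrow> \<exists>a. f = (\<lambda>x. Q x + a)"
    and "g \<in> mfs_power \<Phi> k i j"
  shows "\<exists>a. g = (\<lambda>x. (Q ^^ k) x + a)"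
  using assms(3)
proof (induction k arbitrary: g i j)
  case 0
  then show ?case by (auto simp: fun_eq_iff split: if_splits)
next
  case (Suc k)
  then obtain l h f where "h \<in> mfs_power \<Phi> k i l" "f \<in> \<Phi> l j" "g = h \<circ> f"
    by auto
  moreover from this obtain a b where "h = (\<lambda>x. (Q ^^ k) x + a)" "f = (\<lambda>x. Q x + b)"
    using Suc.IH assms(2) by metis
  moreover have "linear (Q ^^ k)" using assms(1) by (rule linear_funpow)
  ultimately have "g = (\<lambda>x. (Q ^^ Suc k) x + ((Q ^^ k) b + a))"
    by (simp add: fun_eq_iff linear_add funpow_Suc_right del: funpow.simps)
  then show ?case by blast
qed

lemma matrix_matrix_mult_nth: "(A ** B) $ i $ j = (\<Sum>l\<in>UNIV. A $ i $ l * B $ l $ j)"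
  by (simp add: matrix_matrix_mult_def)

text \<open>
  An empty column of \<open>\<Phi>\<close> stays a zero column in every positive power of the substitution matrix.
  Nonempty columns are what makes \<open>L'\<close> invariant under \<open>Q\<close>.
\<close>

lemma primitive_column_nonempty:
  assumes "primitive_mfs \<Phi>"
  shows "\<exists>i f. f \<in> \<Phi> i j"
proof (rule ccontr)
  assume "\<not> ?thesis"
  then have col: "substitution_matrix \<Phi> $ i $ j = 0" for i
    by (simp add: substitution_matrix_def ex_in_conv)
  have "((((**) (substitution_matrix \<Phi>)) ^^ Suc n) (mat 1)) $ i $ j = 0" for n i
  proof (induction n arbitrary: i)
    case 0
    then show ?case using col by (simp add: matrix_mul_rid del: One_nat_def)
  next
    case (Suc n)
    then show ?case by (simp add: matrix_matrix_mult_nth col)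
  qed
  then show False
    using assms unfolding primitive_mfs_def primitive_matrix_def
    by (metis gr0_implies_Suc less_irrefl)
qed

text \<open>
  A positive entry \<open>(i, j)\<close> of a power gives a chain of maps that carries a point of \<open>V\<^sub>j\<close> into \<open>V\<^sub>i\<close>.
\<close>

lemma primitive_fixed_point_nonempty:
  assumes prim: "primitive_mfs \<Phi>" and fix_pt: "mfs_apply \<Phi> V = V" and "V j \<noteq> {}"
  shows "V i \<noteq> {}"
proof -
  have "V i \<noteq> {}" if "((((**) (substitution_matrix \<Phi>)) ^^ n) (mat 1)) $ i $ j > 0" for n i
    using that
  proof (induction n arbitrary: i)
    case 0
    then show ?case using \<open>V j \<noteq> {}\<close> by (auto simp: mat_def split: if_splits)
  next
    case (Suc n)
    let ?S = "substitution_matrix \<Phi>"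
    let ?P = "((**) ?S ^^ n) (mat 1)"
    have "(\<Sum>l\<in>UNIV. ?S $ i $ l * ?P $ l $ j) \<noteq> 0"
      using Suc.prems by (simp only: funpow.simps o_apply matrix_matrix_mult_nth neq0_conv)
    then obtain l where "?S $ i $ l * ?P $ l $ j \<noteq> 0"
      by (meson sum.neutral)
    then have l: "?S $ i $ l > 0" "?P $ l $ j > 0" by simp_all
    then obtain f where "f \<in> \<Phi> i l"
      by (force simp: substitution_matrix_def card_gt_0_iff)
    moreover obtain y where "y \<in> V l" using Suc.IH[OF l(2)] by blast
    ultimately have "f y \<in> V i" using fixed_point_component_iff[OF fix_pt] by blast
    then show ?case by blast
  qed
  then show ?thesis
    using prim unfolding primitive_mfs_def primitive_matrix_def by blast
qed

section \<open>Cosets of \<open>Q\<^sup>k L'\<close> and the sets \<open>\<Psi>\<^sub>k[a]\<close>\<close>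

locale admissible_lss =
  fixes Q :: "real ^ 'd \<Rightarrow> real ^ 'd"
    and V :: "'m::finite \<Rightarrow> (real ^ 'd) set"
    and \<Phi> :: "('d, 'm) mfs"
    and D :: "(real ^ 'd) set"
  assumes primitive: "primitive_lss Q V \<Phi>"
    and digits: "representatives Q (supp V) D"
    and maps: "\<And>i j f. f \<in> \<Phi> i j \<Longrightarrow> \<exists>a\<in>D. f = (\<lambda>x. Q x + a)"
begin

abbreviation "L' \<equiv> sum_lattice V"

lemma Q_linear: "linear Q"
  using primitive
  by (simp add: primitive_lss_def lattice_substitution_system_def is_mfs_def expansive_def)

lemma Q_inj: "inj Q"
  using primitive
  by (simp add: primitive_lss_def lattice_substitution_system_def is_mfs_def expansive_inj)

lemma Q_pow_linear: "linear (Q ^^ k)"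
  using Q_linear by (rule linear_funpow)

lemma fixed_point: "mfs_apply \<Phi> V = V"
  using primitive by (simp add: primitive_lss_def lattice_substitution_system_def)

lemma disjoint: "x \<in> V i \<Longrightarrow> x \<in> V j \<Longrightarrow> i = j"
  using primitive unfolding primitive_lss_def lattice_substitution_system_def by blast

lemma map_into: "f \<in> \<Phi> i j \<Longrightarrow> x \<in> V j \<Longrightarrow> f x \<in> V i"
  using fixed_point_component_iff[OF fixed_point] by blast

lemma supp_group:
  "0 \<in> supp V" "x \<in> supp V \<Longrightarrow> y \<in> supp V \<Longrightarrow> x - y \<in> supp V"
  "x \<in> supp V \<Longrightarrow> y \<in> supp V \<Longrightarrow> x + y \<in> supp V"
  using primitive
  unfolding primitive_lss_def lattice_substitution_system_def is_lattice_def
  by (auto intro: group_closure.diff group_closure_add)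

lemma in_supp: "x \<in> V i \<Longrightarrow> x \<in> supp V"
  by (auto simp: supp_def)

lemma component_nonempty: "V i \<noteq> {}"
proof -
  obtain j where "V j \<noteq> {}" using supp_group(1) by (auto simp: supp_def)
  then show ?thesis
    using primitive fixed_point primitive_fixed_point_nonempty
    unfolding primitive_lss_def by blast
qed

lemma sum_lattice_group:
  "0 \<in> L'" "x \<in> L' \<Longrightarrow> y \<in> L' \<Longrightarrow> x - y \<in> L'"
  by (auto simp: sum_lattice_eq_group_closure intro: group_closure.diff)

lemma diff_in_sum_lattice: "x \<in> V i \<Longrightarrow> y \<in> V i \<Longrightarrow> x - y \<in> L'"
  unfolding sum_lattice_eq_group_closure by (auto intro!: group_closure.base)

lemma sum_lattice_subset_supp: "L' \<subseteq> supp V"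
  unfolding sum_lattice_eq_group_closure
  by (rule group_closure_least) (auto intro: supp_group in_supp)

text \<open>
  For \<open>x, y \<in> V\<^sub>j\<close> and a map \<open>f\<close> in column \<open>j\<close>, \<open>Q (x - y) = f x - f y\<close> is again a difference of two
  points of one component.
\<close>

lemma image_sum_lattice: "Q ` L' \<subseteq> L'"
proof -
  have "group_closure (\<Union>i. {x - y | x y. x \<in> V i \<and> y \<in> V i}) \<subseteq> Q -` L'"
  proof (rule group_closure_least)
    show "(\<Union>i. {x - y |x y. x \<in> V i \<and> y \<in> V i}) \<subseteq> Q -` L'"
    proof clarsimp
      fix j x y assume xy: "x \<in> V j" "y \<in> V j"
      obtain i f where f: "f \<in> \<Phi> i j"
        using primitive primitive_column_nonempty unfolding primitive_lss_def by blast
      then obtain a where "f = (\<lambda>x. Q x + a)" using maps by blast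
      then have "Q (x - y) = f x - f y" by (simp add: linear_diff[OF Q_linear])
      then show "Q (x - y) \<in> L'"
        using f xy map_into diff_in_sum_lattice by metis
    qed
  qed (auto simp: linear_0[OF Q_linear] linear_diff[OF Q_linear] sum_lattice_group)
  then show ?thesis by (auto simp: sum_lattice_eq_group_closure)
qed

abbreviation "M k \<equiv> (Q ^^ k) ` L'"

lemma M_group:
  "0 \<in> M k" "x \<in> M k \<Longrightarrow> y \<in> M k \<Longrightarrow> x - y \<in> M k" "x \<in> M k \<Longrightarrow> y \<in> M k \<Longrightarrow> x + y \<in> M k"
proof -
  show 0: "0 \<in> M k"
    using sum_lattice_group(1) linear_0[OF Q_pow_linear] by (metis imageI)
  show diff: "x - y \<in> M k" if "x \<in> M k" "y \<in> M k" for x y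
    using that sum_lattice_group(2) by (auto simp: linear_diff[OF Q_pow_linear, symmetric])
  show "x + y \<in> M k" if "x \<in> M k" "y \<in> M k"
    using diff[OF that(1) diff[OF 0 that(2)]] by simp
qed

lemma M_Suc: "M (Suc k) = Q ` M k"
  by (simp add: image_comp)

lemma M_subset_sum_lattice: "M k \<subseteq> L'"
proof (induction k)
  case (Suc k)
  then show ?case unfolding M_Suc using image_sum_lattice by blast
qed simp

lemma coset_iff: "x \<in> coset Q V k a \<longleftrightarrow> x - a \<in> M k"
proof
  show "x \<in> coset Q V k a \<Longrightarrow> x - a \<in> M k" by (auto simp: coset_def)
next
  assume "x - a \<in> M k"
  then have "a + (x - a) \<in> coset Q V k a" unfolding coset_def by blast
  then show "x \<in> coset Q V k a" by simp
qed

lemma Psi_iff: "i \<in> Psi Q V k a \<longleftrightarrow> (\<exists>x\<in>V i. x - a \<in> M k)"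
  unfolding Psi_def mem_Collect_eq coset_iff[symmetric] by blast

lemma Psi_cong:
  assumes "a - b \<in> M k"
  shows "Psi Q V k a = Psi Q V k b"
proof -
  have "x - a \<in> M k \<longleftrightarrow> x - b \<in> M k" for x
    using M_group(3)[of "x - a" k "a - b"] M_group(2)[of "x - b" k "a - b"] assms by auto
  then show ?thesis by (auto simp: Psi_iff)
qed

lemma Psi_nonempty:
  assumes "a \<in> supp V"
  shows "Psi Q V k a \<noteq> {}"
  using assms M_group(1)[of k] by (force simp: Psi_iff supp_def)

section \<open>Modular coincidences are singletons\<close>

text \<open>
  A point of \<open>V\<^sub>i\<close> lies in a piece \<open>f(V\<^sub>j)\<close> with \<open>f\<close> in \<open>\<Phi>\<^sup>k\<close>; the linear part of \<open>f\<close> is \<open>Q\<^sup>k\<close>, so if one point of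
  the piece is in \<open>a + Q\<^sup>k L'\<close>, the whole piece is. Conversely an entry of \<open>\<Phi>\<^sup>k[a]\<close> exhibits a point of
  \<open>V\<^sub>i\<close> in the coset, because its piece is nonempty.
\<close>

lemma row_entries_iff_Psi:
  "i \<in> Psi Q V k a \<longleftrightarrow> (\<exists>j f. (i, j, f) \<in> mfs_entries Q V \<Phi> k a)"
proof
  assume "i \<in> Psi Q V k a"
  then obtain x where x: "x \<in> V i" "x - a \<in> M k" by (auto simp: Psi_iff)
  obtain j f y where f: "f \<in> mfs_power \<Phi> k i j" "y \<in> V j" "x = f y"
    using x(1) fixed_point_component_iff[OF mfs_power_fixed_point[OF fixed_point]] by metis
  obtain b where b: "f = (\<lambda>x. (Q ^^ k) x + b)"
    using mfs_power_affine[OF Q_linear _ f(1)] maps by blast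
  have "f ` V j \<subseteq> coset Q V k a"
  proof clarify
    fix z assume "z \<in> V j"
    then have "f z - f y \<in> M k"
      using diff_in_sum_lattice f(2) by (auto simp: b linear_diff[OF Q_pow_linear, symmetric])
    then show "f z \<in> coset Q V k a"
      using M_group(3)[OF _ x(2), of "f z - f y"] f(3) by (simp add: coset_iff)
  qed
  with f(1) show "\<exists>j f. (i, j, f) \<in> mfs_entries Q V \<Phi> k a"
    by (auto simp: mfs_entries_def)
next
  assume "\<exists>j f. (i, j, f) \<in> mfs_entries Q V \<Phi> k a"
  then obtain j f where f: "f \<in> mfs_power \<Phi> k i j" "f ` V j \<subseteq> coset Q V k a"
    by (auto simp: mfs_entries_def)
  obtain y where "y \<in> V j" using component_nonempty by blast
  then have "f y \<in> V i" "f y \<in> coset Q V k a"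
    using f fixed_point_component_iff[OF mfs_power_fixed_point[OF fixed_point]] by blast+
  then show "i \<in> Psi Q V k a" by (auto simp: Psi_iff coset_iff)
qed

text \<open>
  At level \<open>0\<close> a coincidence is an inclusion \<open>a + L' \<subseteq> V\<^sub>i\<close> instead of a condition on rows. The two agree
  because the coset \<open>a + L'\<close> lies in \<open>L\<close> and is therefore covered by the disjoint components that it
  meets.
\<close>

lemma modular_coincidence_iff:
  "modular_coincidence Q V \<Phi> k \<longleftrightarrow> (\<exists>a\<in>supp V. is_singleton (Psi Q V k a))"
proof -
  have single: "is_singleton (Psi Q V k a) \<longleftrightarrow> (\<exists>i. Psi Q V k a \<subseteq> {i})" if "a \<in> supp V" for a
    using Psi_nonempty[OF that, of k] by (auto simp: is_singleton_def)
  show ?thesis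
  proof (cases k)
    case 0
    have "coset Q V 0 a \<subseteq> V i \<longleftrightarrow> Psi Q V 0 a \<subseteq> {i}" if a: "a \<in> supp V" for a i
    proof
      assume "coset Q V 0 a \<subseteq> V i"
      then show "Psi Q V 0 a \<subseteq> {i}"
        using disjoint by (auto simp: Psi_def)
    next
      assume *: "Psi Q V 0 a \<subseteq> {i}"
      show "coset Q V 0 a \<subseteq> V i"
      proof
        fix x assume x: "x \<in> coset Q V 0 a"
        then have "x - a \<in> supp V"
          using sum_lattice_subset_supp by (auto simp: coset_iff)
        then have "x \<in> supp V" using supp_group(3)[OF _ a] by fastforce
        then obtain j where "x \<in> V j" by (auto simp: supp_def)
        with x * show "x \<in> V i" by (auto simp: Psi_def)
      qed
    qed
    then show ?thesis using single 0 by auto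
  next
    case (Suc n)
    have "(\<forall>(i', j, f)\<in>mfs_entries Q V \<Phi> k a. i' = i) \<longleftrightarrow> Psi Q V k a \<subseteq> {i}" for a i
      unfolding subset_iff row_entries_iff_Psi by fastforce
    then show ?thesis using single Suc by simp
  qed
qed

section \<open>Children\<close>

text \<open>
  The set of rows reached from the columns in \<open>S\<close> by the maps with translational part \<open>d\<close>. No level
  \<open>k\<close> and no point \<open>a\<close> occurs in it, which is what makes edges independent of the level.
\<close>

definition successor :: "real ^ 'd \<Rightarrow> 'm set \<Rightarrow> 'm set" where
  "successor d S = {i. \<exists>j\<in>S. (\<lambda>x. Q x + d) \<in> \<Phi> i j}"

text \<open>
  This is where admissibility enters: a coset of \<open>Q\<^sup>k\<^sup>+\<^sup>1 L'\<close> lies in one coset of \<open>Q L\<close>, so all the maps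
  whose pieces meet it share the translational part \<open>d\<close>. Removing \<open>d\<close> and cancelling \<open>Q\<close> leads back to
  the coset of \<open>a\<close> one level below.
\<close>

lemma Psi_Suc_eq_successor:
  assumes a: "a \<in> supp V" and j: "j \<in> Psi Q V k a" and f: "(\<lambda>x. Q x + d) \<in> \<Phi> i j"
  shows "Q a + d \<in> supp V" "Psi Q V (Suc k) (Q a + d) = successor d (Psi Q V k a)"
proof -
  have shift: "(Q x + d) - (Q a + d) \<in> M (Suc k) \<longleftrightarrow> x - a \<in> M k" for x
    using Q_inj by (simp add: M_Suc linear_diff[OF Q_linear, symmetric] inj_image_mem_iff
        del: funpow.simps)
  obtain x where x: "x \<in> V j" "x - a \<in> M k" using j by (auto simp: Psi_iff)
  have "Q x + d \<in> supp V" using map_into[OF f x(1)] by (rule in_supp)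
  moreover have "(Q x + d) - (Q a + d) \<in> supp V"
    using shift x(2) M_subset_sum_lattice sum_lattice_subset_supp by blast
  ultimately have "(Q x + d) - ((Q x + d) - (Q a + d)) \<in> supp V" by (rule supp_group(2))
  then show "Q a + d \<in> supp V" by (simp add: add.commute)
  have dD: "d' \<in> D" if "(\<lambda>x. Q x + d') \<in> \<Phi> i' j'" for d' i' j'
    using maps[OF that] by (metis add_left_cancel)
  show "Psi Q V (Suc k) (Q a + d) = successor d (Psi Q V k a)"
  proof (intro set_eqI iffI)
    fix i' assume "i' \<in> Psi Q V (Suc k) (Q a + d)"
    then obtain z where z: "z \<in> V i'" "z - (Q a + d) \<in> M (Suc k)" by (auto simp: Psi_iff)
    then obtain j' g y where g: "g \<in> \<Phi> i' j'" "y \<in> V j'" "z = g y"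
      using fixed_point_component_iff[OF fixed_point] by blast
    obtain d' where d': "g = (\<lambda>x. Q x + d')" using maps[OF g(1)] by blast
    obtain m where m: "m \<in> M k" "z - (Q a + d) = Q m" using z(2) unfolding M_Suc by blast
    have "a + m \<in> supp V"
      using a m(1) M_subset_sum_lattice sum_lattice_subset_supp supp_group(3) by blast
    moreover have "z - d = Q (a + m)" using m(2) by (simp add: linear_add[OF Q_linear] algebra_simps)
    ultimately have "z - d \<in> Q ` supp V" by blast
    moreover have "z - d' \<in> Q ` supp V" using g(2,3) d' in_supp by auto
    moreover have "z \<in> supp V" using z(1) by (rule in_supp)
    \<comment> \<open>\<open>d\<close> and \<open>d'\<close> are digits representing the same point \<open>z\<close> modulo \<open>Q L\<close>\<close>
    ultimately have "d' = d"
      using digits dD f g(1) d' unfolding representatives_def by blast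
    then have "y - a \<in> M k" using z(2) shift g(3) d' by simp
    then have "j' \<in> Psi Q V k a" using g(2) unfolding Psi_iff by (rule bexI)
    moreover have "(\<lambda>x. Q x + d) \<in> \<Phi> i' j'" using g(1) d' \<open>d' = d\<close> by simp
    ultimately show "i' \<in> successor d (Psi Q V k a)"
      unfolding successor_def by blast
  next
    fix i' assume "i' \<in> successor d (Psi Q V k a)"
    then obtain j' where j': "(\<lambda>x. Q x + d) \<in> \<Phi> i' j'" "j' \<in> Psi Q V k a"
      unfolding successor_def by blast
    obtain y where y: "y \<in> V j'" "y - a \<in> M k" using j'(2) unfolding Psi_iff by (rule bexE)
    have "(Q y + d) - (Q a + d) \<in> M (Suc k)" using y(2) by (simp only: shift)
    then show "i' \<in> Psi Q V (Suc k) (Q a + d)"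
      using map_into[OF j'(1) y(1)] unfolding Psi_iff by (rule bexI)
  qed
qed

lemma child_eq_successor:
  assumes "a \<in> supp V" "is_child Q V \<Phi> k a b"
  obtains i j d where "j \<in> Psi Q V k a" "(\<lambda>x. Q x + d) \<in> \<Phi> i j"
    "Psi Q V (Suc k) b = successor d (Psi Q V k a)"
proof -
  obtain j i f where f: "j \<in> Psi Q V k a" "f \<in> \<Phi> i j" "f a - b \<in> M (Suc k)"
    using assms(2) unfolding is_child_def by blast
  obtain d where d: "f = (\<lambda>x. Q x + d)" using maps[OF f(2)] by blast
  have "Psi Q V (Suc k) b = Psi Q V (Suc k) (Q a + d)"
    using Psi_cong f(3) d by metis
  then show ?thesis
    using that f(1,2) d Psi_Suc_eq_successor(2)[OF assms(1) f(1)] by metis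
qed

text \<open>
  Writing \<open>b = f x\<close> with \<open>x \<in> V\<^sub>j\<close> and \<open>f \<in> \<Phi>\<^sub>i\<^sub>j\<close>, the point \<open>x\<close> works at every level.
\<close>

lemma has_parent:
  assumes "b \<in> supp V"
  obtains a where "a \<in> supp V" "is_child Q V \<Phi> k a b"
proof -
  obtain i where "b \<in> V i" using assms by (auto simp: supp_def)
  then obtain j f x where f: "f \<in> \<Phi> i j" "x \<in> V j" "b = f x"
    using fixed_point_component_iff[OF fixed_point] by blast
  obtain d where d: "f = (\<lambda>x. Q x + d)" using maps[OF f(1)] by blast
  have "f ` V j \<subseteq> coset Q V 1 b"
    using diff_in_sum_lattice[OF _ f(2)]
    by (auto simp: coset_iff f(3) d linear_diff[OF Q_linear, symmetric])
  moreover have "j \<in> Psi Q V k x" unfolding Psi_iff using f(2) M_group(1)[of k] by (metis diff_self)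
  moreover have "f x - b \<in> M (Suc k)" using M_group(1) f(3) by (metis diff_self)
  ultimately have "is_child Q V \<Phi> k x b"
    using f(1) unfolding is_child_def by blast
  with that f(2) in_supp show ?thesis by blast
qed

section \<open>Paths in the coincidence graph\<close>

abbreviation "G \<equiv> coincidence_graph Q V \<Phi>"

lemma Psi_in_verts: "a \<in> supp V \<Longrightarrow> Psi Q V k a \<in> verts G"
  by (auto simp: coincidence_graph_def)

lemma arcs_iff:
  "e \<in> arcs G \<longleftrightarrow> (\<exists>k a b. e = (Psi Q V k a, Psi Q V (Suc k) b) \<and>
     a \<in> supp V \<and> b \<in> supp V \<and> is_child Q V \<Phi> k a b)"
  by (auto simp: coincidence_graph_def)

lemma arc_ends: "tail G = fst" "head G = snd"
  by (simp_all add: coincidence_graph_def)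

sublocale wf_digraph "coincidence_graph Q V \<Phi>"
proof
  fix e assume "e \<in> arcs G"
  then obtain k a b where "e = (Psi Q V k a, Psi Q V (Suc k) b)" "a \<in> supp V" "b \<in> supp V"
    unfolding arcs_iff by blast
  then show "tail G e \<in> verts G" "head G e \<in> verts G"
    by (simp_all only: arc_ends fst_conv snd_conv Psi_in_verts)
qed

text \<open>
  An edge out of the vertex \<open>\<Psi>\<^sub>k[a]\<close> may have arisen from an equal set \<open>\<Psi>\<^sub>l[a']\<close> at another level \<open>l\<close>. Its
  target is \<open>successor d\<close> of that common set for some \<open>d\<close>, and the same set arises from \<open>\<Psi>\<^sub>k[a]\<close> with the
  point \<open>Q a + d\<close>.
\<close>

lemma arc_lift:
  assumes "a \<in> supp V" "e \<in> arcs G" "tail G e = Psi Q V k a"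
  shows "\<exists>b\<in>supp V. head G e = Psi Q V (Suc k) b"
proof -
  obtain l a' b' where e: "a' \<in> supp V" "is_child Q V \<Phi> l a' b'"
    "e = (Psi Q V l a', Psi Q V (Suc l) b')"
    using assms(2) unfolding arcs_iff by blast
  have same: "Psi Q V l a' = Psi Q V k a"
    using assms(3) e(3) by (simp add: arc_ends)
  obtain i j d where "j \<in> Psi Q V k a" "(\<lambda>x. Q x + d) \<in> \<Phi> i j"
    "Psi Q V (Suc l) b' = successor d (Psi Q V k a)"
    using child_eq_successor[OF e(1,2)] unfolding same by metis
  then have "Q a + d \<in> supp V" "head G e = Psi Q V (Suc k) (Q a + d)"
    using Psi_Suc_eq_successor[OF assms(1)] e(3) by (simp_all add: arc_ends)
  then show ?thesis by blast
qed

lemma walk_lift: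
  assumes "awalk (Psi Q V k a) p v" "a \<in> supp V"
  shows "\<exists>b\<in>supp V. v = Psi Q V (k + length p) b"
  using assms
proof (induction p arbitrary: k a)
  case Nil
  then show ?case by (auto simp: awalk_Nil_iff)
next
  case (Cons e p)
  then have e: "e \<in> arcs G" "tail G e = Psi Q V k a" "awalk (head G e) p v"
    by (auto simp: awalk_Cons_iff)
  obtain b where "b \<in> supp V" "head G e = Psi Q V (Suc k) b"
    using arc_lift[OF Cons.prems(2) e(1,2)] by blast
  with Cons.IH[of "Suc k" b] e(3) show ?case by simp
qed

lemma walk_from_base_point:
  assumes "b \<in> supp V"
  shows "\<exists>u\<in>base_points Q V. \<exists>p. awalk u p (Psi Q V k b) \<and> length p = k"
  using assms
proof (induction k arbitrary: b)
  case 0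
  then have "awalk (Psi Q V 0 b) [] (Psi Q V 0 b)"
    by (simp add: awalk_Nil_iff Psi_in_verts)
  with 0 show ?case by (auto simp: base_points_def)
next
  case (Suc k)
  obtain a where a: "a \<in> supp V" "is_child Q V \<Phi> k a b"
    using has_parent[OF Suc.prems] by blast
  let ?e = "(Psi Q V k a, Psi Q V (Suc k) b)"
  have "?e \<in> arcs G" using a Suc.prems unfolding arcs_iff by blast
  then have "awalk (Psi Q V k a) [?e] (Psi Q V (Suc k) b)"
    using arc_implies_awalk[of ?e] by (simp add: arc_ends)
  moreover obtain u p where "u \<in> base_points Q V" "awalk u p (Psi Q V k a)" "length p = k"
    using Suc.IH[OF a(1)] by blast
  ultimately show ?case using awalk_appendI
    by (intro bexI[of _ u] exI[of _ "p @ [?e]"]) auto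
qed

lemma singleton_walk_imp_coincidence:
  assumes "u \<in> base_points Q V" "awalk u p v" "is_singleton v"
  shows "modular_coincidence Q V \<Phi> (length p)"
proof -
  obtain a where "a \<in> supp V" "u = Psi Q V 0 a"
    using assms(1) by (auto simp: base_points_def)
  then show ?thesis
    using walk_lift[of 0 a p v] assms by (auto simp: modular_coincidence_iff)
qed

lemma singleton_path_imp_coincidence:
  "singleton_path_length Q V \<Phi> n \<Longrightarrow> modular_coincidence Q V \<Phi> n"
  unfolding singleton_path_length_def
  using singleton_walk_imp_coincidence by (auto simp: apath_def)

text \<open>
  Paths, unlike walks, must not repeat vertices. Here this follows from minimality of \<open>k\<close>, since
  removing a cycle from the walk keeps both ends and shortens it.
\<close>

lemma least_coincidence_imp_singleton_path:
  assumes mc: "modular_coincidence Q V \<Phi> k"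
    and least: "\<And>n. modular_coincidence Q V \<Phi> n \<Longrightarrow> k \<le> n"
  shows "singleton_path_length Q V \<Phi> k"
proof -
  obtain b where b: "b \<in> supp V" "is_singleton (Psi Q V k b)"
    using mc by (auto simp: modular_coincidence_iff)
  obtain u p where u: "u \<in> base_points Q V" and walk: "awalk u p (Psi Q V k b)"
    and len: "length p = k"
    using walk_from_base_point[OF b(1)] by blast
  have "distinct (awalk_verts u p)"
  proof (rule ccontr)
    assume "\<not> ?thesis"
    then obtain q r s w where "p = q @ r @ s" "0 < length r" "awalk u q w" "awalk w s (Psi Q V k b)"
      using awalk_not_distinct_decomp[OF walk] by blast
    then have "length (q @ s) < k" "awalk u (q @ s) (Psi Q V k b)"
      using len by (auto intro: awalk_appendI simp del: awalk_append_iff)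
    then show False
      using least[OF singleton_walk_imp_coincidence[OF u _ b(2)]] by (meson not_le)
  qed
  then have "apath u p (Psi Q V k b)" using walk by (simp add: apath_def)
  moreover have "Psi Q V k b \<in> verts G" using b(1) by (rule Psi_in_verts)
  ultimately show ?thesis
    using u b(2) len unfolding singleton_path_length_def by blast
qed

lemma singleton_vertex_iff:
  "(\<exists>v\<in>verts G. is_singleton v) \<longleftrightarrow> (\<exists>k. modular_coincidence Q V \<Phi> k)"
  by (auto simp: coincidence_graph_def modular_coincidence_iff)

end

theorem theorem4p4:
  fixes Q :: "real ^ 'd \<Rightarrow> real ^ 'd"
    and V :: "'m::finite \<Rightarrow> (real ^ 'd) set"
    and \<Phi> :: "('d, 'm) mfs"
  assumes "primitive_lss Q V \<Phi>"
    and "admissible Q V \<Phi>"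
    and "clusters_generated V \<Phi>"
  shows "((\<exists>k. modular_coincidence Q V \<Phi> k) \<longleftrightarrow>
            (\<exists>v\<in>verts (coincidence_graph Q V \<Phi>). is_singleton v)) \<and>
         ((\<exists>v\<in>verts (coincidence_graph Q V \<Phi>). is_singleton v) \<longrightarrow>
            (\<exists>n. singleton_path_length Q V \<Phi> n) \<and>
            (LEAST n. singleton_path_length Q V \<Phi> n) = (LEAST k. modular_coincidence Q V \<Phi> k))"
proof -
  obtain D where D: "representatives Q (supp V) D"
    "\<forall>i j. \<forall>f\<in>\<Phi> i j. \<exists>a\<in>D. f = (\<lambda>x. Q x + a)"
    using assms(2) unfolding admissible_def by blast
  interpret admissible_lss Q V \<Phi> D
    using assms(1) D by unfold_locales auto
  define k where "k = (LEAST k. modular_coincidence Q V \<Phi> k)"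
  have path: "singleton_path_length Q V \<Phi> k" if "\<exists>k. modular_coincidence Q V \<Phi> k"
    unfolding k_def
    by (rule least_coincidence_imp_singleton_path) (use that in \<open>auto intro: LeastI_ex Least_le\<close>)
  moreover have "(LEAST n. singleton_path_length Q V \<Phi> n) = k"
    if "\<exists>k. modular_coincidence Q V \<Phi> k"
  proof (rule Least_equality)
    show "singleton_path_length Q V \<Phi> k" using path that .
    show "k \<le> n" if "singleton_path_length Q V \<Phi> n" for n
      using singleton_path_imp_coincidence[OF that] by (auto simp: k_def intro: Least_le)
  qed
  ultimately show ?thesis
    unfolding singleton_vertex_iff k_def[symmetric] by blast
qed

end
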